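(* Let $\alpha>0$ and $\beta>0$ be real numbers, and let $X$ be a real random variable following the Gamma distribution with shape parameter $\alpha$ and scale parameter $\beta$. Then for all positive integers $m,n$ with $n>m$, $$E(X^n)^{\frac{1}{n}} \geq E(X^m)^{\frac{1}{m}}.$$
   Context: The Gamma distribution with shape parameter $\alpha>0$ and scale parameter $\beta>0$ is the probability distribution on $\mathbb{R}$ with density (with respect to Lebesgue measure) $f(x)=\frac{1}{\beta^{\alpha}\Gamma(\alpha)}x^{\alpha-1}e^{-x/\beta}$ for $x>0$ and $f(x)=0$ for $x\le 0$, where $\Gamma(\alpha)=\int_0^\infty t^{\alpha-1}e^{-t}\,dt$ is the Gamma function. For a positive integer $i$, $E(X^i)=\int_{-\infty}^{\infty}x^i f(x)\,dx$ denotes the $i$-th moment of $X$. *)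

theory Defs
  imports "HOL-Probability.Probability"
begin

text \<open>Shape \<open>\<alpha>\<close>, scale (not rate) \<open>\<beta>\<close>. The library's \<open>Gamma\<close> is defined by a limit; for positive
  \<open>\<alpha>\<close> it agrees with the Euler integral by \<open>Gamma_integral_real\<close>.\<close>

definition gamma_density :: "real \<Rightarrow> real \<Rightarrow> real \<Rightarrow> real" where
  "gamma_density \<alpha> \<beta> x =
     (if x > 0 then 1 / (\<beta> powr \<alpha> * Gamma \<alpha>) * x powr (\<alpha> - 1) * exp (- x / \<beta>) else 0)"

lemma gamma_density_nonneg:
  assumes "\<alpha> > 0" "\<beta> > 0"
  shows "gamma_density \<alpha> \<beta> x \<ge> 0"
  using assms Gamma_real_pos[of \<alpha>] by (simp add: gamma_density_def)

text \<open>The expectation of \<open>X ^ i\<close> is the moment integral against the density.\<close>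

lemma (in prob_space) gamma_moment_eq_integral:
  fixes X :: "'a \<Rightarrow> real"
  assumes "\<alpha> > 0" "\<beta> > 0"
    and "distributed M lborel X (\<lambda>x. ennreal (gamma_density \<alpha> \<beta> x))"
  shows "expectation (\<lambda>\<omega>. X \<omega> ^ i) = (LBINT x. x ^ i * gamma_density \<alpha> \<beta> x)"
  using distributed_integral[OF assms(3), of "\<lambda>x. x ^ i"] gamma_density_nonneg[OF assms(1,2)]
  by (simp add: mult.commute set_lebesgue_integral_def)

end

theory Submission
  imports Defs
begin

text \<open>Lyapunov's inequality: apply Jensen's inequality to \<open>X ^ m\<close> and the convex function
  \<open>y \<mapsto> y powr (n / m)\<close>. The Gamma distribution is concentrated on the positive reals, and its
  moments are finite because they are Gamma integrals.\<close>

text \<open>Domination by \<open>1 + \<bar>X \<omega> ^ n\<bar>\<close>: the constant covers the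
  points where the absolute value is at most 1, the higher power covers the rest. The constant is
  integrable because the total mass is finite.\<close>

lemma (in prob_space) integrable_power_le:
  fixes X :: "'a \<Rightarrow> real"
  assumes [measurable]: "random_variable borel X"
    and "integrable M (\<lambda>\<omega>. X \<omega> ^ n)" and "m \<le> n"
  shows "integrable M (\<lambda>\<omega>. X \<omega> ^ m)"
proof (rule Bochner_Integration.integrable_bound)
  show "integrable M (\<lambda>\<omega>. 1 + \<bar>X \<omega> ^ n\<bar>)"
    using assms(2) by (intro Bochner_Integration.integrable_add integrable_abs) simp_all
  have "\<bar>x\<bar> ^ m \<le> 1 + \<bar>x\<bar> ^ n" for x :: real
  proof (cases "\<bar>x\<bar> \<le> 1")
    case True
    then have "\<bar>x\<bar> ^ m \<le> 1" by (simp add: power_le_one)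
    moreover have "0 \<le> \<bar>x\<bar> ^ n" by simp
    ultimately show ?thesis by linarith
  next
    case False
    then have "\<bar>x\<bar> ^ m \<le> \<bar>x\<bar> ^ n" using \<open>m \<le> n\<close> by (intro power_increasing) auto
    then show ?thesis by simp
  qed
  then show "AE \<omega> in M. norm (X \<omega> ^ m) \<le> norm (1 + \<bar>X \<omega> ^ n\<bar>)"
    by (auto simp: power_abs)
qed measurable

lemma (in prob_space) lyapunov_inequality:
  fixes X :: "'a \<Rightarrow> real"
  assumes [measurable]: "random_variable borel X"
    and pos: "AE \<omega> in M. X \<omega> > 0"
    and int_n: "integrable M (\<lambda>\<omega>. X \<omega> ^ n)"
    and mn: "0 < m" "m \<le> n"
  shows "expectation (\<lambda>\<omega>. X \<omega> ^ m) powr (1 / m) \<le> expectation (\<lambda>\<omega>. X \<omega> ^ n) powr (1 / n)"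
proof -
  define p where "p = real n / real m"
  have p: "p \<ge> 1" using mn by (simp add: p_def)
  have int_m: "integrable M (\<lambda>\<omega>. X \<omega> ^ m)"
    by (rule integrable_power_le[OF assms(1) int_n mn(2)])
  \<comment> \<open>The exponents multiply to \<open>m * p = n\<close>. Passing between natural
    powers and \<open>powr\<close> uses a positive base, hence an identity almost everywhere
    only.\<close>
  have eq: "AE \<omega> in M. (X \<omega> ^ m) powr p = X \<omega> ^ n"
    using pos
  proof eventually_elim
    case (elim \<omega>)
    then have "(X \<omega> ^ m) powr p = (X \<omega> powr real m) powr p"
      by (simp add: powr_realpow)
    also have "\<dots> = X \<omega> powr real n" using mn by (simp add: powr_powr p_def)
    also have "\<dots> = X \<omega> ^ n" using elim by (simp add: powr_realpow)
    finally show ?case .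
  qed
  have "expectation (\<lambda>\<omega>. X \<omega> ^ m) powr p \<le> expectation (\<lambda>\<omega>. (X \<omega> ^ m) powr p)"
  proof (rule jensens_inequality[where I = "{0<..}"])
    show "AE \<omega> in M. X \<omega> ^ m \<in> {0<..}"
      using pos by eventually_elim simp
    show "integrable M (\<lambda>\<omega>. (X \<omega> ^ m) powr p)"
      using int_n eq by (subst integrable_cong_AE[where g = "\<lambda>\<omega>. X \<omega> ^ n"]) auto
    show "convex_on {0<..} (\<lambda>x. x powr p)"
      by (rule powr_convex[OF p])
  qed (use int_m in auto)
  also have "\<dots> = expectation (\<lambda>\<omega>. X \<omega> ^ n)"
    using eq by (intro integral_cong_AE) auto
  finally have le: "expectation (\<lambda>\<omega>. X \<omega> ^ m) powr p \<le> expectation (\<lambda>\<omega>. X \<omega> ^ n)" .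
  \<comment> \<open>Since \<open>p * (1 / n) = 1 / m\<close>, the claim is the n-th root of
    \<open>le\<close>. The root is monotone here because a \<open>powr\<close> value is
    nonnegative.\<close>
  have "expectation (\<lambda>\<omega>. X \<omega> ^ m) powr (1 / m) = (expectation (\<lambda>\<omega>. X \<omega> ^ m) powr p) powr (1 / n)"
    using mn by (simp add: powr_powr p_def)
  also have "\<dots> \<le> expectation (\<lambda>\<omega>. X \<omega> ^ n) powr (1 / n)"
    using le by (intro powr_mono2) auto
  finally show ?thesis .
qed

lemma borel_measurable_gamma_density [measurable]: "gamma_density \<alpha> \<beta> \<in> borel_measurable borel"
  unfolding gamma_density_def by measurable

text \<open>Up to the normalizing constant, the integrand is that of the Euler integral at the
  argument \<open>\<alpha> + n\<close> with rate \<open>1 / \<beta>\<close>, which converges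
  absolutely.\<close>

lemma integrable_power_gamma_density:
  assumes "\<alpha> > 0" "\<beta> > 0"
  shows "integrable lborel (\<lambda>x. gamma_density \<alpha> \<beta> x * x ^ n)"
proof -
  have "(\<lambda>t. complex_of_real t powr (of_real (\<alpha> + n) - 1) / of_real (exp (1 / \<beta> * t)))
      absolutely_integrable_on {0<..}"
    using assms by (intro absolutely_integrable_Gamma_integral) auto
  \<comment> \<open>Taking norms turns the complex powers into real ones; the indicator becomes the
    zero branch of \<open>gamma_density\<close>.\<close>
  then have "integrable lebesgue (\<lambda>t. norm (indicator {0<..} t *\<^sub>R
      (complex_of_real t powr (of_real (\<alpha> + n) - 1) / of_real (exp (1 / \<beta> * t)))))"
    unfolding set_integrable_def by (rule integrable_norm)
  then have "integrable lebesgue (\<lambda>t. 1 / (\<beta> powr \<alpha> * Gamma \<alpha>) * norm (indicator {0<..} t *\<^sub>R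
      (complex_of_real t powr (of_real (\<alpha> + n) - 1) / of_real (exp (1 / \<beta> * t)))))"
    by (rule integrable_mult_right)
  also have "(\<lambda>t. 1 / (\<beta> powr \<alpha> * Gamma \<alpha>) * norm (indicator {0<..} t *\<^sub>R
      (complex_of_real t powr (of_real (\<alpha> + n) - 1) / of_real (exp (1 / \<beta> * t)))))
     = (\<lambda>x. gamma_density \<alpha> \<beta> x * x ^ n)"
  proof
    fix t :: real
    show "1 / (\<beta> powr \<alpha> * Gamma \<alpha>) * norm (indicator {0<..} t *\<^sub>R
      (complex_of_real t powr (of_real (\<alpha> + n) - 1) / of_real (exp (1 / \<beta> * t))))
      = gamma_density \<alpha> \<beta> t * t ^ n"
    proof (cases "t > 0")
      case True
      have "t powr (\<alpha> + n - 1) = t powr (\<alpha> - 1) * t ^ n"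
        using True by (simp add: powr_add [symmetric] powr_realpow [symmetric] algebra_simps)
      with True show ?thesis
        by (simp add: gamma_density_def norm_divide norm_powr_real_powr exp_minus field_simps)
    qed (simp add: gamma_density_def)
  qed
  finally show ?thesis
    \<comment> \<open>\<open>lebesgue\<close> is the completion of \<open>lborel\<close>, and for a
      Borel measurable function integrability over the two is equivalent.\<close>
    by (subst (asm) integrable_completion) measurable
qed

theorem theorem2:
  fixes \<alpha> \<beta> :: real and M :: "'a measure" and X :: "'a \<Rightarrow> real" and m n :: nat
  assumes "\<alpha> > 0" and "\<beta> > 0"
    and "prob_space M"
    and "distributed M lborel X (\<lambda>x. ennreal (gamma_density \<alpha> \<beta> x))"
    and "m > 0" and "n > m"
  shows "(prob_space.expectation M (\<lambda>\<omega>. X \<omega> ^ n)) powr (1 / real n)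
           \<ge> (prob_space.expectation M (\<lambda>\<omega>. X \<omega> ^ m)) powr (1 / real m)"
proof -
  interpret prob_space M by fact
  have X [measurable]: "random_variable borel X"
    using distributed_measurable[OF assms(4)] by simp
  \<comment> \<open>Change of variables: integrability of \<open>X ^ n\<close> over \<open>M\<close>
    becomes that of the moment integrand on the line.\<close>
  have "integrable lborel (\<lambda>x. gamma_density \<alpha> \<beta> x * x ^ n) \<longleftrightarrow> integrable M (\<lambda>\<omega>. X \<omega> ^ n)"
    by (rule distributed_integrable[OF assms(4)])
      (use gamma_density_nonneg[OF assms(1,2)] in auto)
  then have "integrable M (\<lambda>\<omega>. X \<omega> ^ n)"
    using integrable_power_gamma_density[OF assms(1,2)] by simp
  moreover have "AE \<omega> in M. X \<omega> > 0"
    \<comment> \<open>An almost sure property of \<open>X\<close> has to be checked only where the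
      density is positive, and there \<open>x > 0\<close> by definition.\<close>
    by (subst distributed_AE2[OF assms(4)]) (auto simp: gamma_density_def)
  ultimately show ?thesis
    using lyapunov_inequality[OF X] assms by simp
qed

end
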